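(* Let $n\ge 2$, let $B$ be a real symmetric $(n-1)\times(n-1)$ matrix, let $a\in\mathbb{R}^{n-1}$, and let \[A=\begin{pmatrix}0&a^T\\ a&B\end{pmatrix}.\] Put $\rho_2=\rho(B)$, $\nu=a^Ta$, $\mu=|a^TBa|$, and let $\theta^*$ be the largest real root of the polynomial \[g(x)=(x-\nu)^2(\rho_2^2+x)-\mu^2.\] Then $\rho(A)^2=\rho_2^2+\theta^*$ if and only if $B^2a=\rho_2^2\,a$.
   Context: For a square matrix $Z$, $\rho(Z)$ denotes its spectral radius, i.e. the maximum modulus of its eigenvalues. *)

theory Defs
  imports Complex_Main "Jordan_Normal_Form.Spectral_Radius"
begin

text \<open>The eigenvalues of a real matrix are taken over the complex numbers. For a
  \<open>0 \<times> 0\<close> matrix the spectrum is empty and the value is unspecified.\<close>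

definition real_spectral_radius :: "real mat \<Rightarrow> real" where
  "real_spectral_radius M = spectral_radius (map_mat complex_of_real M)"

definition bordered_mat :: "real vec \<Rightarrow> real mat \<Rightarrow> real mat" where
  "bordered_mat a B = four_block_mat (0\<^sub>m 1 1) (mat_of_row a) (mat_of_row a)\<^sup>T B"

text \<open>\<open>(x - \<nu>)\<^sup>2 (r\<^sup>2 + x) - \<mu>\<^sup>2\<close>; monic of degree 3, so its set of real roots is
  finite and nonempty.\<close>

definition g_poly :: "real \<Rightarrow> real \<Rightarrow> real \<Rightarrow> real poly" where
  "g_poly r \<nu> \<mu> = [:- \<nu>, 1:]\<^sup>2 * [:r\<^sup>2, 1:] - [:\<mu>\<^sup>2:]"

end

theory Submission
  imports Defs
begin

text \<open>
  Let \<open>r = \<rho>(B)\<close>, and let \<open>k\<close> be a real eigenvalue of the bordered matrix with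
  \<open>\<bar>k\<bar> > r\<close>. The border component of an eigenvector cannot vanish, as \<open>k\<close> would then be an
  eigenvalue of \<open>B\<close>; scaling it to \<open>1\<close>, the eigenvector is \<open>(1, y)\<close> with
  \<open>a = (k - B) y\<close> and \<open>a \<bullet> y = k\<close>. For \<open>k > 0\<close> these two equations give
  \<open>k (k\<^sup>2 - r\<^sup>2 - \<nu>) = a \<bullet> B a - \<delta>\<close> with \<open>\<delta> = y \<bullet> (k - B)(r\<^sup>2 - B\<^sup>2) y\<close>,
  and \<open>\<delta> \<ge> 0\<close> because \<open>k - B\<close> and \<open>r\<^sup>2 - B\<^sup>2\<close> are commuting positive semidefinite
  matrices. So \<open>x = k\<^sup>2 - r\<^sup>2\<close> satisfies \<open>x < \<nu>\<close> or \<open>g(x) \<le> 0\<close>, and in both cases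
  \<open>x \<le> \<theta>\<close>. Negative \<open>k\<close> reduces to this by passing from \<open>B\<close> to \<open>-B\<close>, which is why only
  \<open>\<bar>a \<bullet> B a\<bar>\<close> enters \<open>g\<close>. If \<open>x = \<theta>\<close>, then
  \<open>\<bar>k\<bar> (x - \<nu>) = \<mu>\<close>, which forces \<open>\<delta> = 0\<close>, and this in turn puts \<open>y\<close>, hence \<open>a\<close>, in the
  kernel of \<open>r\<^sup>2 - B\<^sup>2\<close> (\<open>secular_inequality\<close>, \<open>bordered_real_spectral_radius_bound\<close>).

  Conversely, if \<open>B\<^sup>2 a = r\<^sup>2 a\<close> and \<open>\<theta> > 0\<close>, then \<open>(k - B)\<close> is inverted on \<open>a\<close> by
  \<open>(k + B) / (k\<^sup>2 - r\<^sup>2)\<close>. With \<open>k = \<plusminus>sqrt (r\<^sup>2 + \<theta>)\<close>, of the sign of \<open>a \<bullet> B a\<close>, this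
  exhibits an explicit eigenvector of the bordered matrix
  (\<open>abs_le_bordered_real_spectral_radius\<close>), so the upper bound is attained.

  No diagonalisation is involved. The spectral input on real symmetric matrices is that the
  spectral radius is the modulus of a real eigenvalue
  (\<open>symmetric_real_spectral_radius_attained\<close>) and bounds its action on vectors
  (\<open>symmetric_norm_le_real_spectral_radius\<close>).
\<close>

section \<open>Scalar products of real vectors\<close>

lemma scalar_prod_self_nonneg: "0 \<le> (v :: real vec) \<bullet> v"
  by (simp add: scalar_prod_def sum_nonneg)

lemma scalar_prod_self_eq_0_iff:
  assumes "(v :: real vec) \<in> carrier_vec m"
  shows "v \<bullet> v = 0 \<longleftrightarrow> v = 0\<^sub>v m"
proof
  assume "v \<bullet> v = 0"
  then have "\<forall>i\<in>{0..<dim_vec v}. v $ i * v $ i = 0"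
    unfolding scalar_prod_def by (subst (asm) sum_nonneg_eq_0_iff) auto
  then show "v = 0\<^sub>v m" using assms by (intro eq_vecI) auto
qed (use assms in simp)

text \<open>All the quadratic expressions below are products of vectors of the shape \<open>c u - v\<close>.\<close>

lemma scalar_prod_smult_minus:
  assumes "(u :: real vec) \<in> carrier_vec m" "v \<in> carrier_vec m"
    "w \<in> carrier_vec m" "z \<in> carrier_vec m"
  shows "(c \<cdot>\<^sub>v u - v) \<bullet> (d \<cdot>\<^sub>v w - z)
    = c * d * (u \<bullet> w) - c * (u \<bullet> z) - d * (v \<bullet> w) + v \<bullet> z"
  using assms
  by (simp add: scalar_prod_minus_distrib[of _ m] minus_scalar_prod_distrib[of _ m] algebra_simps)

lemma scalar_prod_Cauchy_Schwarz:
  assumes v: "(v :: real vec) \<in> carrier_vec m" and w: "w \<in> carrier_vec m"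
  shows "(v \<bullet> w)\<^sup>2 \<le> (v \<bullet> v) * (w \<bullet> w)"
proof (cases "v \<bullet> v = 0")
  case True
  then have "v = 0\<^sub>v m" using scalar_prod_self_eq_0_iff[OF v] by simp
  then show ?thesis using w by simp
next
  case False
  then have pos: "0 < v \<bullet> v" using scalar_prod_self_nonneg[of v] by linarith
  \<comment> \<open>the component of \<open>w\<close> orthogonal to \<open>v\<close>, cleared of denominators\<close>
  let ?p = "(v \<bullet> v) \<cdot>\<^sub>v w - (v \<bullet> w) \<cdot>\<^sub>v v"
  have "?p \<bullet> ?p = (v \<bullet> v) * ((v \<bullet> v) * (w \<bullet> w) - (v \<bullet> w)\<^sup>2)"
    using v w comm_scalar_prod[OF v w]
    by (subst scalar_prod_smult_minus[of _ m]) (auto simp: algebra_simps power2_eq_square)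
  then have "0 \<le> (v \<bullet> v) * ((v \<bullet> v) * (w \<bullet> w) - (v \<bullet> w)\<^sup>2)"
    using scalar_prod_self_nonneg[of ?p] by simp
  then show ?thesis using pos by (simp add: zero_le_mult_iff)
qed

lemma symmetric_scalar_prod:
  assumes "(M :: real mat) \<in> carrier_mat m m" "M\<^sup>T = M" "u \<in> carrier_vec m" "v \<in> carrier_vec m"
  shows "(M *\<^sub>v u) \<bullet> v = u \<bullet> (M *\<^sub>v v)"
  using transpose_vec_mult_scalar[OF assms(1,4,3)] assms
  by (metis comm_scalar_prod mult_mat_vec_carrier)

section \<open>The spectral radius of a real symmetric matrix\<close>

lemma abs_eigenvalue_le_real_spectral_radius:
  assumes M: "(M :: real mat) \<in> carrier_mat m m" and v: "v \<in> carrier_vec m" "v \<noteq> 0\<^sub>v m"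
    and Mv: "M *\<^sub>v v = k \<cdot>\<^sub>v v"
  shows "\<bar>k\<bar> \<le> real_spectral_radius M"
proof -
  let ?C = "map_mat complex_of_real M" and ?v = "map_vec complex_of_real v"
  have C: "?C \<in> carrier_mat m m" using M by simp
  have "m > 0" using v by (cases m) auto
  have "?C *\<^sub>v ?v = map_vec complex_of_real (k \<cdot>\<^sub>v v)"
    using of_real_hom.mult_mat_vec_hom[OF M v(1)] unfolding Mv by (rule sym)
  then have "?C *\<^sub>v ?v = complex_of_real k \<cdot>\<^sub>v ?v" by (simp add: of_real_hom.vec_hom_smult)
  then have "eigenvector ?C ?v (complex_of_real k)"
    using v M unfolding eigenvector_def by simp
  then have "complex_of_real k \<in> spectrum ?C" unfolding spectrum_def eigenvalue_def by auto
  then have "norm (complex_of_real k) \<in> norm ` spectrum ?C" by (rule imageI)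
  from spectral_radius_mem_max(2)[OF C \<open>m > 0\<close> this]
  show ?thesis unfolding real_spectral_radius_def by simp
qed

text \<open>
  Take a complex eigenvector \<open>x + i y\<close> for an eigenvalue of maximal modulus. Comparing
  \<open>M x \<bullet> y\<close> with \<open>x \<bullet> M y\<close> shows that the eigenvalue is real, so that \<open>x\<close> and \<open>y\<close> each
  satisfy the eigenvalue equation, and one of them is nonzero.
\<close>

lemma symmetric_real_spectral_radius_attained:
  assumes M: "(M :: real mat) \<in> carrier_mat m m" and sym: "M\<^sup>T = M" and m: "m > 0"
  obtains k v where "v \<in> carrier_vec m" "v \<noteq> 0\<^sub>v m" "M *\<^sub>v v = k \<cdot>\<^sub>v v"
    "\<bar>k\<bar> = real_spectral_radius M"
proof -
  let ?C = "map_mat complex_of_real M"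
  have C: "?C \<in> carrier_mat m m" using M by simp
  from spectral_radius_mem_max(1)[OF C m] obtain e where
    "e \<in> spectrum ?C" and ne: "norm e = real_spectral_radius M"
    unfolding real_spectral_radius_def by auto
  then obtain c where c: "c \<in> carrier_vec m" "c \<noteq> 0\<^sub>v m" and Cc: "?C *\<^sub>v c = e \<cdot>\<^sub>v c"
    using M unfolding spectrum_def eigenvalue_def eigenvector_def by auto
  define x where "x = map_vec Re c"
  define y where "y = map_vec Im c"
  have x: "x \<in> carrier_vec m" and y: "y \<in> carrier_vec m" using c unfolding x_def y_def by auto
  have comp: "(\<Sum>j<m. complex_of_real (M $$ (i, j)) * c $ j) = e * c $ i" if "i < m" for i
    using arg_cong[OF Cc, of "\<lambda>v. v $ i"] that c M
    by (simp add: scalar_prod_def lessThan_atLeast0)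
  have Mx: "M *\<^sub>v x = Re e \<cdot>\<^sub>v x - Im e \<cdot>\<^sub>v y"
  proof (intro eq_vecI)
    fix i assume "i < dim_vec (Re e \<cdot>\<^sub>v x - Im e \<cdot>\<^sub>v y)"
    then have i: "i < m" using x y by simp
    show "(M *\<^sub>v x) $ i = (Re e \<cdot>\<^sub>v x - Im e \<cdot>\<^sub>v y) $ i"
      using arg_cong[OF comp[OF i], of Re] i c M
      by (simp add: scalar_prod_def lessThan_atLeast0 x_def y_def)
  qed (use M x y in auto)
  have My: "M *\<^sub>v y = Re e \<cdot>\<^sub>v y + Im e \<cdot>\<^sub>v x"
  proof (intro eq_vecI)
    fix i assume "i < dim_vec (Re e \<cdot>\<^sub>v y + Im e \<cdot>\<^sub>v x)"
    then have i: "i < m" using x y by simp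
    show "(M *\<^sub>v y) $ i = (Re e \<cdot>\<^sub>v y + Im e \<cdot>\<^sub>v x) $ i"
      using arg_cong[OF comp[OF i], of Im] i c M
      by (simp add: scalar_prod_def lessThan_atLeast0 x_def y_def)
  qed (use M x y in auto)
  have nz: "x \<noteq> 0\<^sub>v m \<or> y \<noteq> 0\<^sub>v m"
  proof (rule ccontr)
    assume "\<not> ?thesis"
    then have "x = 0\<^sub>v m" "y = 0\<^sub>v m" by auto
    then have "c $ i = 0" if "i < m" for i
    proof -
      have "x $ i = 0" "y $ i = 0" using that \<open>x = 0\<^sub>v m\<close> \<open>y = 0\<^sub>v m\<close> by simp_all
      then show ?thesis using that c(1) unfolding x_def y_def by (simp add: complex_eq_iff)
    qed
    then show False using c by (auto simp: vec_eq_iff)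
  qed
  have "Im e * (x \<bullet> x + y \<bullet> y) = 0"
    using symmetric_scalar_prod[OF M sym x y] x y unfolding Mx My
    by (simp add: scalar_prod_add_distrib[of _ m] minus_scalar_prod_distrib[of _ m] algebra_simps)
  moreover have "x \<bullet> x + y \<bullet> y \<noteq> 0"
    using nz scalar_prod_self_nonneg[of x] scalar_prod_self_nonneg[of y]
      scalar_prod_self_eq_0_iff[OF x] scalar_prod_self_eq_0_iff[OF y] by linarith
  ultimately have im: "Im e = 0" by simp
  have "\<bar>Re e\<bar> = real_spectral_radius M" using ne im by (simp add: cmod_def)
  moreover have "M *\<^sub>v x = Re e \<cdot>\<^sub>v x" using Mx im x y by (intro eq_vecI) auto
  moreover have "M *\<^sub>v y = Re e \<cdot>\<^sub>v y" using My im x y by (intro eq_vecI) auto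
  ultimately show ?thesis using nz that[OF x] that[OF y] by blast
qed

lemma pow_mat_Suc_mult_vec:
  assumes N: "(N :: real mat) \<in> carrier_mat m m" and v: "v \<in> carrier_vec m"
  shows "N ^\<^sub>m (Suc k) *\<^sub>v v = N *\<^sub>v (N ^\<^sub>m k *\<^sub>v v)"
  using v
proof (induction k arbitrary: v)
  case (Suc k)
  have Nv: "N *\<^sub>v v \<in> carrier_vec m" using N Suc.prems by auto
  have shift: "N ^\<^sub>m (Suc j) *\<^sub>v v = N ^\<^sub>m j *\<^sub>v (N *\<^sub>v v)" for j
    using assoc_mult_mat_vec[OF pow_carrier_mat[OF N] N Suc.prems] by simp
  show ?case unfolding shift[of "Suc k"] Suc.IH[OF Nv] shift[of k] ..
qed (use N in simp)

text \<open>Log-convexity makes the ratios \<open>f (k+1) / f k\<close> nondecreasing, so the first one bounds all.\<close>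

lemma log_convex_geometric_growth:
  fixes f :: "nat \<Rightarrow> real"
  assumes conv: "\<And>k. (f (Suc k))\<^sup>2 \<le> f k * f (Suc (Suc k))"
    and f0: "0 < f 0" and q: "0 < q" "q * f 0 \<le> f 1"
  shows "q ^ k * f 0 \<le> f k"
proof -
  have step: "0 < f k \<and> q * f k \<le> f (Suc k)" for k
  proof (induction k)
    case (Suc k)
    then have pos: "0 < f (Suc k)" using q(1) by (metis less_le_trans mult_pos_pos)
    have "q * f k * f (Suc k) \<le> f (Suc k) * f (Suc k)"
      using Suc pos by (intro mult_right_mono) auto
    also have "\<dots> \<le> f k * f (Suc (Suc k))" using conv[of k] by (simp add: power2_eq_square)
    finally have "f k * (q * f (Suc k)) \<le> f k * f (Suc (Suc k))" by (simp add: ac_simps)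
    then show ?case using pos Suc by simp
  qed (use f0 q in simp)
  show ?thesis
  proof (induction k)
    case (Suc k)
    have "q ^ Suc k * f 0 = q * (q ^ k * f 0)" by simp
    also have "\<dots> \<le> q * f k" using Suc q by simp
    also have "\<dots> \<le> f (Suc k)" using step by simp
    finally show ?case .
  qed simp
qed

lemma real_spectral_radius_nonneg:
  assumes M: "(M :: real mat) \<in> carrier_mat m m" and m: "m > 0"
  shows "0 \<le> real_spectral_radius M"
  using spectral_radius_mem_max(1)[of "map_mat complex_of_real M" m] M m
  unfolding real_spectral_radius_def by auto

text \<open>
  The spectral radius dominates the Euclidean operator norm of a symmetric matrix. The
  argument runs through powers. By symmetry and Cauchy-Schwarz the squared lengths of the
  iterates \<open>N\<^sup>k v\<close> form a log-convex sequence; if \<open>N\<close> lengthens \<open>v\<close>, they grow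
  geometrically. If the bound failed at \<open>v\<close>, one could choose \<open>s\<close> strictly between \<open>\<rho>(M)\<close> and
  \<open>\<bar>M v\<bar> / \<bar>v\<bar>\<close>; for \<open>N = M / s\<close> this growth contradicts the boundedness of the powers of a
  matrix whose spectral radius is below \<open>1\<close>.
\<close>

lemma symmetric_norm_le_real_spectral_radius:
  assumes M: "(M :: real mat) \<in> carrier_mat m m" and sym: "M\<^sup>T = M"
    and v: "v \<in> carrier_vec m"
  shows "(M *\<^sub>v v) \<bullet> (M *\<^sub>v v) \<le> (real_spectral_radius M)\<^sup>2 * (v \<bullet> v)"
proof (cases "v = 0\<^sub>v m")
  case True
  then have "M *\<^sub>v v = 0\<^sub>v m" using M by auto
  then show ?thesis using True by simp
next
  case False
  then have m: "m > 0" using v by (cases m) auto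
  have vv: "0 < v \<bullet> v"
    using False scalar_prod_self_nonneg[of v] scalar_prod_self_eq_0_iff[OF v] by linarith
  let ?r = "real_spectral_radius M"
  have r: "0 \<le> ?r" by (rule real_spectral_radius_nonneg[OF M m])
  show ?thesis
  proof (rule ccontr)
    assume "\<not> ?thesis"
    then have "?r\<^sup>2 < (M *\<^sub>v v) \<bullet> (M *\<^sub>v v) / (v \<bullet> v)" (is "_ < ?t")
      using vv by (simp add: field_simps)
    then have "?r < sqrt ?t" using real_less_rsqrt by blast
    then obtain s where s: "?r < s" "s < sqrt ?t" using dense by blast
    have s0: "0 < s" using r s by simp
    have "s\<^sup>2 < ?t" using s s0 by (metis less_eq_real_def not_le real_le_lsqrt real_sqrt_le_iff real_sqrt_unique)
    define q where "q = ?t / s\<^sup>2"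
    have q: "1 < q" using \<open>s\<^sup>2 < ?t\<close> s0 unfolding q_def by (subst less_divide_eq_1_pos) auto
    define N where "N = (1 / s) \<cdot>\<^sub>m M"
    have N: "N \<in> carrier_mat m m" using M unfolding N_def by simp
    have Nv: "N *\<^sub>v x = (1 / s) \<cdot>\<^sub>v (M *\<^sub>v x)" if "x \<in> carrier_vec m" for x
      using M that unfolding N_def by (intro eq_vecI) auto
    have M_ij: "M $$ (j, i) = M $$ (i, j)" if "i < m" "j < m" for i j
      using that M arg_cong[OF sym, of "\<lambda>X. X $$ (i, j)"] by simp
    have Nsym: "N\<^sup>T = N" using M_ij M unfolding N_def by (intro eq_matI) auto
    obtain k w where w: "w \<in> carrier_vec m" "w \<noteq> 0\<^sub>v m" "N *\<^sub>v w = k \<cdot>\<^sub>v w"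
      and k: "\<bar>k\<bar> = real_spectral_radius N"
      by (rule symmetric_real_spectral_radius_attained[OF N Nsym m])
    have "M *\<^sub>v w = s \<cdot>\<^sub>v (N *\<^sub>v w)" using s0 M w(1) unfolding Nv[OF w(1)] by (intro eq_vecI) auto
    then have "M *\<^sub>v w = (s * k) \<cdot>\<^sub>v w" unfolding w(3) by (simp add: smult_smult_assoc)
    then have "\<bar>s * k\<bar> \<le> ?r" by (rule abs_eigenvalue_le_real_spectral_radius[OF M w(1,2)])
    then have "s * \<bar>k\<bar> \<le> ?r" using s0 by (simp add: abs_mult)
    then have "s * \<bar>k\<bar> < s * 1" using s(1) by linarith
    then have "\<bar>k\<bar> < 1" using mult_less_cancel_left_pos[OF s0] by blast
    then have "spectral_radius (map_mat complex_of_real N) < 1"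
      using k s0 unfolding real_spectral_radius_def by simp
    from spectral_radius_jnf_norm_bound_less_1_upper_triangular[OF _ this] N
    obtain c where c: "\<And>k. norm_bound (map_mat complex_of_real N ^\<^sub>m k) c" by fastforce
    have entry: "\<bar>(N ^\<^sub>m k) $$ (i, j)\<bar> \<le> c" if "i < m" "j < m" for i j k
    proof -
      have "norm ((map_mat complex_of_real (N ^\<^sub>m k)) $$ (i, j)) \<le> c"
        using c[of k] that N pow_carrier_mat[OF N, of k]
        unfolding of_real_hom.mat_hom_pow[OF N, symmetric] norm_bound_def by auto
      then show ?thesis using that N by simp
    qed
    define f where "f k = (N ^\<^sub>m k *\<^sub>v v) \<bullet> (N ^\<^sub>m k *\<^sub>v v)" for k
    define D where "D = (\<Sum>j<m. c * \<bar>v $ j\<bar>)"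
    have car: "N ^\<^sub>m k *\<^sub>v v \<in> carrier_vec m" for k
      using pow_carrier_mat[OF N, of k] v by auto
    have pow_Suc: "N ^\<^sub>m (Suc k) *\<^sub>v v = N *\<^sub>v (N ^\<^sub>m k *\<^sub>v v)" for k
      by (rule pow_mat_Suc_mult_vec[OF N v])
    \<comment> \<open>\<open>D\<close> bounds every entry of every iterate, because \<open>c\<close> bounds the entries of the powers\<close>
    have f_le: "f k \<le> real m * D\<^sup>2" for k
    proof -
      have "\<bar>(N ^\<^sub>m k *\<^sub>v v) $ i\<bar> \<le> D" if i: "i < m" for i
      proof -
        have "(N ^\<^sub>m k *\<^sub>v v) $ i = (\<Sum>j<m. (N ^\<^sub>m k) $$ (i, j) * v $ j)"
          using i v N by (simp add: scalar_prod_def lessThan_atLeast0)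
        also have "\<bar>\<dots>\<bar> \<le> (\<Sum>j<m. \<bar>(N ^\<^sub>m k) $$ (i, j) * v $ j\<bar>)" by (rule sum_abs)
        also have "\<dots> \<le> D" unfolding D_def
          using entry[OF i] by (intro sum_mono) (auto simp: abs_mult intro: mult_right_mono)
        finally show ?thesis .
      qed
      then have "(\<Sum>i<m. (N ^\<^sub>m k *\<^sub>v v) $ i * (N ^\<^sub>m k *\<^sub>v v) $ i) \<le> (\<Sum>i<m. D\<^sup>2)"
        by (intro sum_mono) (metis abs_le_square_iff abs_of_nonneg abs_ge_zero lessThan_iff order_trans power2_eq_square)
      then show ?thesis unfolding f_def scalar_prod_def carrier_vecD[OF car] lessThan_atLeast0 by simp
    qed
    have "q ^ k * f 0 \<le> f k" for k
    proof (rule log_convex_geometric_growth)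
      show "(f (Suc k))\<^sup>2 \<le> f k * f (Suc (Suc k))" for k
      proof -
        let ?x = "N ^\<^sub>m k *\<^sub>v v" and ?z = "N ^\<^sub>m (Suc (Suc k)) *\<^sub>v v"
        \<comment> \<open>moving one factor \<open>N\<close> across the scalar product\<close>
        have "f (Suc k) = ?x \<bullet> ?z"
          using symmetric_scalar_prod[OF N Nsym car[of k] car[of "Suc k"]]
          unfolding f_def pow_Suc by simp
        then show ?thesis
          using scalar_prod_Cauchy_Schwarz[OF car[of k] car[of "Suc (Suc k)"]] unfolding f_def by simp
      qed
      show "0 < f 0" using vv v N unfolding f_def by simp
      have "f 1 = (1 / s) * ((1 / s) * ((M *\<^sub>v v) \<bullet> (M *\<^sub>v v)))"
        using M N v unfolding f_def by (simp add: pow_Suc Nv[OF v])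
      then show "q * f 0 \<le> f 1"
        using vv s0 v N unfolding q_def f_def by (simp add: power2_eq_square field_simps)
    qed (use q in simp)
    then have le: "q ^ k * (v \<bullet> v) \<le> real m * D\<^sup>2" for k
      using f_le[of k] order_trans v N unfolding f_def by fastforce
    obtain k where "real m * D\<^sup>2 / (v \<bullet> v) < q ^ k" using real_arch_pow[OF q] by blast
    then show False using le[of k] vv by (simp add: field_simps)
  qed
qed

section \<open>The defect in the secular equation\<close>

text \<open>A matrix of norm at most \<open>r\<close> makes \<open>r + B\<close> positive semidefinite.\<close>

lemma scalar_prod_mult_mat_ge:
  assumes B: "(B :: real mat) \<in> carrier_mat m m"
    and r: "0 \<le> r"
    and bound: "(B *\<^sub>v z) \<bullet> (B *\<^sub>v z) \<le> r\<^sup>2 * (z \<bullet> z)"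
    and z: "z \<in> carrier_vec m"
  shows "0 \<le> r * (z \<bullet> z) + z \<bullet> (B *\<^sub>v z)"
proof -
  have "(z \<bullet> (B *\<^sub>v z))\<^sup>2 \<le> (z \<bullet> z) * ((B *\<^sub>v z) \<bullet> (B *\<^sub>v z))"
    using scalar_prod_Cauchy_Schwarz[of z m "B *\<^sub>v z"] B z by auto
  also have "\<dots> \<le> (z \<bullet> z) * (r\<^sup>2 * (z \<bullet> z))"
    by (rule mult_left_mono[OF bound scalar_prod_self_nonneg])
  also have "\<dots> = (r * (z \<bullet> z))\<^sup>2" by (simp add: power2_eq_square)
  finally have "\<bar>z \<bullet> (B *\<^sub>v z)\<bar> \<le> r * (z \<bullet> z)"
    using abs_le_square_iff[of "z \<bullet> (B *\<^sub>v z)" "r * (z \<bullet> z)"] r scalar_prod_self_nonneg[of z] by simp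
  then show ?thesis by linarith
qed

text \<open>
  The difference of the two sides is \<open>\<delta> = y \<bullet> (l - B)(r\<^sup>2 - B\<^sup>2) y\<close>. To see its sign without
  diagonalising, split \<open>l - B = (l - r) + (r - B)\<close> and put \<open>z = (r - B) y\<close>; then
  \<open>\<delta> = (l - r) (r\<^sup>2 \<bar>y\<bar>\<^sup>2 - \<bar>B y\<bar>\<^sup>2) + z \<bullet> (r + B) z\<close>, a sum of nonnegative terms.
  If \<open>\<delta> = 0\<close>, then \<open>\<bar>B y\<bar> = r \<bar>y\<bar>\<close> since \<open>l > r\<close>. This is the extremal case of the norm bound,
  where \<open>B\<^sup>2 y = r\<^sup>2 y\<close>, and \<open>a = (l - B) y\<close> inherits the equation.
\<close>

lemma secular_inequality:
  assumes B: "(B :: real mat) \<in> carrier_mat m m" and sym: "B\<^sup>T = B"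
    and bound: "\<And>v. v \<in> carrier_vec m \<Longrightarrow> (B *\<^sub>v v) \<bullet> (B *\<^sub>v v) \<le> r\<^sup>2 * (v \<bullet> v)"
    and r: "0 \<le> r" "r < l"
    and y: "y \<in> carrier_vec m"
    and a: "a = l \<cdot>\<^sub>v y - B *\<^sub>v y" and ay: "a \<bullet> y = l"
  shows "l * (l\<^sup>2 - r\<^sup>2 - a \<bullet> a) \<le> a \<bullet> (B *\<^sub>v a)"
    and "l * (l\<^sup>2 - r\<^sup>2 - a \<bullet> a) = a \<bullet> (B *\<^sub>v a) \<Longrightarrow> B *\<^sub>v (B *\<^sub>v a) = r\<^sup>2 \<cdot>\<^sub>v a"
proof -
  \<comment> \<open>every quantity involved is a combination of scalar products of \<open>y\<close>, \<open>B y\<close> and \<open>B\<^sup>2 y\<close>\<close>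
  define u where "u = B *\<^sub>v y"
  define w where "w = B *\<^sub>v u"
  define z where "z = r \<cdot>\<^sub>v y - u"
  have u: "u \<in> carrier_vec m" and w: "w \<in> carrier_vec m" and z: "z \<in> carrier_vec m"
    using B y unfolding z_def w_def u_def by auto
  have Ba: "B *\<^sub>v a = l \<cdot>\<^sub>v u - w"
    using B y u unfolding a w_def
    by (simp add: u_def[symmetric] mult_minus_distrib_mat_vec[OF B] mult_mat_vec[OF B])
  have Bz: "B *\<^sub>v z = r \<cdot>\<^sub>v u - w"
    using B y u unfolding z_def w_def
    by (simp add: u_def[symmetric] mult_minus_distrib_mat_vec[OF B] mult_mat_vec[OF B])
  have yw: "y \<bullet> w = u \<bullet> u"
    using symmetric_scalar_prod[OF B sym y u] unfolding w_def u_def by simp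
  have uy: "u \<bullet> y = y \<bullet> u" and wy: "w \<bullet> y = u \<bullet> u"
    using comm_scalar_prod[OF u y] comm_scalar_prod[OF w y] yw by auto
  have aa: "a \<bullet> a = l\<^sup>2 * (y \<bullet> y) - 2 * l * (y \<bullet> u) + u \<bullet> u"
    unfolding a u_def[symmetric] scalar_prod_smult_minus[OF y u y u] uy
    by (simp add: power2_eq_square)
  have aBa: "a \<bullet> (B *\<^sub>v a) = l\<^sup>2 * (y \<bullet> u) - 2 * l * (u \<bullet> u) + u \<bullet> w"
    unfolding Ba unfolding a u_def[symmetric] scalar_prod_smult_minus[OF y u u w] yw
    by (simp add: power2_eq_square)
  have zz: "z \<bullet> z = r\<^sup>2 * (y \<bullet> y) - 2 * r * (y \<bullet> u) + u \<bullet> u"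
    unfolding z_def scalar_prod_smult_minus[OF y u y u] uy
    by (simp add: power2_eq_square)
  have zBz: "z \<bullet> (B *\<^sub>v z) = r\<^sup>2 * (y \<bullet> u) - 2 * r * (u \<bullet> u) + u \<bullet> w"
    unfolding Bz unfolding z_def scalar_prod_smult_minus[OF y u u w] yw
    by (simp add: power2_eq_square)
  have l: "l = l * (y \<bullet> y) - y \<bullet> u"
    using ay y u unfolding a u_def[symmetric]
    by (simp add: minus_scalar_prod_distrib[of _ m] uy)
  have expand: "a \<bullet> (B *\<^sub>v a) - l * (l\<^sup>2 - r\<^sup>2 - a \<bullet> a)
    = (l - r) * (r\<^sup>2 * (y \<bullet> y) - u \<bullet> u) + (r * (z \<bullet> z) + z \<bullet> (B *\<^sub>v z))"
  proof -
    \<comment> \<open>both sides agree as polynomials once the leading \<open>l\<close> is expanded as \<open>a \<bullet> y\<close>,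
      but only where it multiplies \<open>l\<^sup>2 - r\<^sup>2\<close>\<close>
    have "l * (l\<^sup>2 - r\<^sup>2 - a \<bullet> a)
        = (l * (y \<bullet> y) - y \<bullet> u) * (l\<^sup>2 - r\<^sup>2) - l * (a \<bullet> a)"
      unfolding l[symmetric] by (simp add: algebra_simps)
    then show ?thesis unfolding aBa zz zBz aa
      by (simp add: algebra_simps power2_eq_square)
  qed
  have Q: "0 \<le> r\<^sup>2 * (y \<bullet> y) - u \<bullet> u" using bound[OF y] unfolding u_def by simp
  have Z: "0 \<le> r * (z \<bullet> z) + z \<bullet> (B *\<^sub>v z)"
    by (rule scalar_prod_mult_mat_ge[OF B r(1) bound[OF z] z])
  have lQ: "0 \<le> (l - r) * (r\<^sup>2 * (y \<bullet> y) - u \<bullet> u)" using Q r by simp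
  show "l * (l\<^sup>2 - r\<^sup>2 - a \<bullet> a) \<le> a \<bullet> (B *\<^sub>v a)"
    using expand lQ Z by linarith
  assume "l * (l\<^sup>2 - r\<^sup>2 - a \<bullet> a) = a \<bullet> (B *\<^sub>v a)"
  then have "(l - r) * (r\<^sup>2 * (y \<bullet> y) - u \<bullet> u) = 0" using expand lQ Z by linarith
  then have Q0: "u \<bullet> u = r\<^sup>2 * (y \<bullet> y)" using r by simp
  \<comment> \<open>\<open>\<bar>r\<^sup>2 y - B\<^sup>2 y\<bar>\<^sup>2 = \<bar>B\<^sup>2 y\<bar>\<^sup>2 - r\<^sup>2 \<bar>B y\<bar>\<^sup>2 \<le> 0\<close>, by the norm bound at \<open>B y\<close>\<close>
  have "(r\<^sup>2 \<cdot>\<^sub>v y - w) \<bullet> (r\<^sup>2 \<cdot>\<^sub>v y - w) = w \<bullet> w - r\<^sup>2 * (u \<bullet> u)"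
    unfolding scalar_prod_smult_minus[OF y w y w] yw wy using Q0 by (simp add: algebra_simps)
  also have "\<dots> \<le> 0" using bound[OF u] unfolding w_def by simp
  finally have "r\<^sup>2 \<cdot>\<^sub>v y - w = 0\<^sub>v m"
    using scalar_prod_self_nonneg[of "r\<^sup>2 \<cdot>\<^sub>v y - w"] scalar_prod_self_eq_0_iff[of "r\<^sup>2 \<cdot>\<^sub>v y - w" m] y w by simp
  then have wr: "w = r\<^sup>2 \<cdot>\<^sub>v y"
    using y w
    by (intro eq_vecI) (auto simp: vec_eq_iff)
  have "B *\<^sub>v (B *\<^sub>v a) = l \<cdot>\<^sub>v w - B *\<^sub>v w"
    using B u w unfolding Ba w_def
    by (simp add: mult_minus_distrib_mat_vec[OF B] mult_mat_vec[OF B])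
  also have "B *\<^sub>v w = r\<^sup>2 \<cdot>\<^sub>v u" unfolding wr u_def by (rule mult_mat_vec[OF B y])
  finally show "B *\<^sub>v (B *\<^sub>v a) = r\<^sup>2 \<cdot>\<^sub>v a"
    unfolding wr a u_def[symmetric] using y u by (intro eq_vecI) (auto simp: algebra_simps)
qed

text \<open>
  For \<open>k < 0\<close> replace \<open>k\<close>, \<open>y\<close>, \<open>B\<close> by their negatives: both equations and the norm bound
  persist, while \<open>a \<bullet> B a\<close> changes sign.
\<close>

lemma secular_inequality_abs:
  assumes B: "(B :: real mat) \<in> carrier_mat m m" and sym: "B\<^sup>T = B"
    and bound: "\<And>v. v \<in> carrier_vec m \<Longrightarrow> (B *\<^sub>v v) \<bullet> (B *\<^sub>v v) \<le> r\<^sup>2 * (v \<bullet> v)"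
    and r: "0 \<le> r" "r < \<bar>k\<bar>"
    and y: "y \<in> carrier_vec m"
    and a: "a = k \<cdot>\<^sub>v y - B *\<^sub>v y" and ay: "a \<bullet> y = k"
  shows "\<bar>k\<bar> * (k\<^sup>2 - r\<^sup>2 - a \<bullet> a) \<le> \<bar>a \<bullet> (B *\<^sub>v a)\<bar>"
    and "\<bar>k\<bar> * (k\<^sup>2 - r\<^sup>2 - a \<bullet> a) = \<bar>a \<bullet> (B *\<^sub>v a)\<bar> \<Longrightarrow> B *\<^sub>v (B *\<^sub>v a) = r\<^sup>2 \<cdot>\<^sub>v a"
proof -
  have a_car: "a \<in> carrier_vec m" using B y unfolding a by auto
  have "\<bar>k\<bar> * (k\<^sup>2 - r\<^sup>2 - a \<bullet> a) \<le> \<bar>a \<bullet> (B *\<^sub>v a)\<bar> \<and>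
    (\<bar>k\<bar> * (k\<^sup>2 - r\<^sup>2 - a \<bullet> a) = \<bar>a \<bullet> (B *\<^sub>v a)\<bar> \<longrightarrow> B *\<^sub>v (B *\<^sub>v a) = r\<^sup>2 \<cdot>\<^sub>v a)"
  proof (cases "0 \<le> k")
    case True
    then have rk: "r < k" using r by simp
    show ?thesis
      using secular_inequality[OF B sym bound r(1) rk y a ay] True by force
  next
    case False
    then have rk: "r < - k" using r by simp
    have uB: "- B \<in> carrier_mat m m" using B by simp
    have usym: "(- B)\<^sup>T = - B" using sym transpose_uminus[of B] by metis
    have uBv: "- B *\<^sub>v v = - (B *\<^sub>v v)" if "v \<in> carrier_vec m" for v
      using B that by (intro eq_vecI) auto
    have uminus_uminus: "(- v) \<bullet> (- v) = v \<bullet> v" if "v \<in> carrier_vec m" for v :: "real vec"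
      using that by (simp add: scalar_prod_def)
    have ubound: "(- B *\<^sub>v v) \<bullet> (- B *\<^sub>v v) \<le> r\<^sup>2 * (v \<bullet> v)" if "v \<in> carrier_vec m" for v
      using bound[OF that] B that uBv[OF that] uminus_uminus[of "B *\<^sub>v v"] by auto
    have uy: "- y \<in> carrier_vec m" using y by simp
    have ua: "a = (- k) \<cdot>\<^sub>v (- y) - (- B) *\<^sub>v (- y)"
      using B y unfolding a by (intro eq_vecI) auto
    have uay: "a \<bullet> (- y) = - k" using ay a_car y by simp
    have q: "a \<bullet> (- B *\<^sub>v a) = - (a \<bullet> (B *\<^sub>v a))"
      using uBv[OF a_car] a_car B by simp
    have sq: "- B *\<^sub>v (- B *\<^sub>v a) = B *\<^sub>v (B *\<^sub>v a)"
      using B a_car by (intro eq_vecI) (auto simp: uBv)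
    note s = secular_inequality[OF uB usym ubound r(1) rk uy ua uay, unfolded q sq]
    show ?thesis using s False by force
  qed
  then show "\<bar>k\<bar> * (k\<^sup>2 - r\<^sup>2 - a \<bullet> a) \<le> \<bar>a \<bullet> (B *\<^sub>v a)\<bar>"
    and "\<bar>k\<bar> * (k\<^sup>2 - r\<^sup>2 - a \<bullet> a) = \<bar>a \<bullet> (B *\<^sub>v a)\<bar> \<Longrightarrow> B *\<^sub>v (B *\<^sub>v a) = r\<^sup>2 \<cdot>\<^sub>v a"
    by auto
qed

section \<open>Roots of the cubic\<close>

lemma poly_g_poly: "poly (g_poly r \<nu> \<mu>) x = (x - \<nu>)\<^sup>2 * (r\<^sup>2 + x) - \<mu>\<^sup>2"
  unfolding g_poly_def by (simp add: power2_eq_square algebra_simps)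

text \<open>
  The cubic is positive from \<open>\<nu> + 1 + \<mu>\<^sup>2\<close> on, so by the intermediate value theorem every point
  where it is nonpositive lies at or below a root. In particular \<open>\<nu> \<le> \<theta>\<close>, as its value
  at \<open>\<nu>\<close> is \<open>-\<mu>\<^sup>2\<close>.
\<close>

lemma g_poly_roots:
  fixes r \<nu> \<mu> x :: real
  assumes nu: "0 \<le> \<nu>"
  defines "\<theta> \<equiv> Max {x. poly (g_poly r \<nu> \<mu>) x = 0}"
  shows g_poly_max_root: "(\<theta> - \<nu>)\<^sup>2 * (r\<^sup>2 + \<theta>) = \<mu>\<^sup>2"
    and g_poly_nonpos_le_max_root: "(x - \<nu>)\<^sup>2 * (r\<^sup>2 + x) \<le> \<mu>\<^sup>2 \<Longrightarrow> x \<le> \<theta>"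
proof -
  let ?g = "g_poly r \<nu> \<mu>" and ?X = "\<nu> + 1 + \<mu>\<^sup>2"
  have beyond: "0 < poly ?g y" if "?X \<le> y" for y
  proof -
    have "\<mu>\<^sup>2 < (1 + \<mu>\<^sup>2)\<^sup>2 * 1"
      using self_le_power[of "1 + \<mu>\<^sup>2" 2] by simp
    also have "\<dots> \<le> (y - \<nu>)\<^sup>2 * (r\<^sup>2 + y)"
    proof (rule mult_mono)
      show "(1 + \<mu>\<^sup>2)\<^sup>2 \<le> (y - \<nu>)\<^sup>2" using that by (intro power_mono) auto
      have "1 \<le> y" using that nu zero_le_power2[of \<mu>] by linarith
      then show "1 \<le> r\<^sup>2 + y" using zero_le_power2[of r] by linarith
    qed auto
    finally show ?thesis unfolding poly_g_poly by linarith
  qed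
  have "?g \<noteq> 0" using beyond[of ?X] by auto
  then have fin: "finite {x. poly ?g x = 0}" by (rule poly_roots_finite)
  have root: "\<exists>z\<ge>x. poly ?g z = 0" if "poly ?g x \<le> 0" for x
  proof (cases "poly ?g x = 0")
    case False
    then have neg: "poly ?g x < 0" using that by simp
    then have "x < ?X" using beyond[of x] by force
    from poly_IVT_pos[OF this neg beyond] show ?thesis by (auto intro: less_imp_le)
  qed auto
  have "poly ?g \<nu> \<le> 0" unfolding poly_g_poly by simp
  then have "{x. poly ?g x = 0} \<noteq> {}" using root by blast
  from Max_in[OF fin this] have "poly ?g \<theta> = 0" unfolding \<theta>_def by simp
  then show "(\<theta> - \<nu>)\<^sup>2 * (r\<^sup>2 + \<theta>) = \<mu>\<^sup>2" unfolding poly_g_poly by simp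
  assume "(x - \<nu>)\<^sup>2 * (r\<^sup>2 + x) \<le> \<mu>\<^sup>2"
  then obtain z where "x \<le> z" "poly ?g z = 0" using root[of x] unfolding poly_g_poly by auto
  then show "x \<le> \<theta>" unfolding \<theta>_def using Max_ge[OF fin, of z] by simp
qed

section \<open>Eigenvectors of the bordered matrix\<close>

lemma bordered_mat_carrier:
  assumes "B \<in> carrier_mat m m" "a \<in> carrier_vec m"
  shows "bordered_mat a B \<in> carrier_mat (Suc m) (Suc m)"
  using assms unfolding bordered_mat_def carrier_mat_def by simp

lemma bordered_mat_transpose:
  assumes B: "B \<in> carrier_mat m m" and sym: "B\<^sup>T = B" and a: "a \<in> carrier_vec m"
  shows "(bordered_mat a B)\<^sup>T = bordered_mat a B"
proof -
  have B_ij: "B $$ (j, i) = B $$ (i, j)" if "i < m" "j < m" for i j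
    using that B arg_cong[OF sym, of "\<lambda>X. X $$ (i, j)"] by simp
  show ?thesis
    using a B unfolding bordered_mat_def by (intro eq_matI) (auto simp: B_ij)
qed

lemma bordered_mat_mult_vCons:
  assumes B: "B \<in> carrier_mat m m" and a: "a \<in> carrier_vec m" and y: "y \<in> carrier_vec m"
  shows "bordered_mat a B *\<^sub>v vCons t y = vCons (a \<bullet> y) (t \<cdot>\<^sub>v a + B *\<^sub>v y)"
proof -
  have v: "vCons t y = vCons t vNil @\<^sub>v y" by simp
  have t: "vCons t vNil \<in> carrier_vec 1" by (simp add: carrier_vecI)
  have row: "mat_of_row a \<in> carrier_mat 1 m" using a by simp
  have "bordered_mat a B *\<^sub>v vCons t y
    = (0\<^sub>m 1 1 *\<^sub>v vCons t vNil + mat_of_row a *\<^sub>v y)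
      @\<^sub>v ((mat_of_row a)\<^sup>T *\<^sub>v vCons t vNil + B *\<^sub>v y)"
    unfolding v bordered_mat_def
    by (rule four_block_mat_mult_vec[OF _ row _ B t y]) (use row in auto)
  also have "0\<^sub>m 1 1 *\<^sub>v vCons t vNil + mat_of_row a *\<^sub>v y = vCons (a \<bullet> y) vNil"
    by (intro eq_vecI) (auto simp: carrier_vecI)
  also have "(mat_of_row a)\<^sup>T *\<^sub>v vCons t vNil = t \<cdot>\<^sub>v a"
    using a by (intro eq_vecI) (auto simp: scalar_prod_def)
  finally show ?thesis by simp
qed

text \<open>
  If the border component of the eigenvector were \<open>0\<close>, the rest of it would be an eigenvector of
  \<open>B\<close> for \<open>k\<close>, contrary to \<open>\<rho>(B) < \<bar>k\<bar>\<close>; hence it can be scaled to \<open>1\<close>.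
\<close>

lemma bordered_eigenvector_normalized:
  assumes B: "(B :: real mat) \<in> carrier_mat m m" and sym: "B\<^sup>T = B" and a: "a \<in> carrier_vec m"
    and v: "v \<in> carrier_vec (Suc m)" "v \<noteq> 0\<^sub>v (Suc m)" "bordered_mat a B *\<^sub>v v = k \<cdot>\<^sub>v v"
    and gt: "real_spectral_radius B < \<bar>k\<bar>"
  obtains y where "y \<in> carrier_vec m" "a = k \<cdot>\<^sub>v y - B *\<^sub>v y" "a \<bullet> y = k"
proof -
  obtain t z where vz: "v = vCons t z" and z: "z \<in> carrier_vec m" using v(1) by (cases v) auto
  have "vCons (a \<bullet> z) (t \<cdot>\<^sub>v a + B *\<^sub>v z) = vCons (k * t) (k \<cdot>\<^sub>v z)"
  proof -
    have "k \<cdot>\<^sub>v vCons t z = vCons (k * t) (k \<cdot>\<^sub>v z)"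
      by (intro eq_vecI) (auto simp: vec_index_vCons)
    then show ?thesis using v(3) unfolding vz bordered_mat_mult_vCons[OF B a z] by simp
  qed
  then have az: "a \<bullet> z = k * t" and Bz: "t \<cdot>\<^sub>v a + B *\<^sub>v z = k \<cdot>\<^sub>v z" by auto
  have Bz_i: "t * a $ i + (B *\<^sub>v z) $ i = k * z $ i" if "i < m" for i
    using arg_cong[OF Bz, of "\<lambda>v. v $ i"] that a B z by simp
  have "t \<noteq> 0"
  proof
    assume t: "t = 0"
    then have "z \<noteq> 0\<^sub>v m" using v(2) unfolding vz zero_vec_Suc by auto
    moreover have "B *\<^sub>v z = k \<cdot>\<^sub>v z" using Bz_i B z unfolding t by (intro eq_vecI) auto
    ultimately show False
      using abs_eigenvalue_le_real_spectral_radius[OF B z, of k] gt by simp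
  qed
  show thesis
  proof
    show y: "(1 / t) \<cdot>\<^sub>v z \<in> carrier_vec m" using z by simp
    show "a \<bullet> ((1 / t) \<cdot>\<^sub>v z) = k" using az a z \<open>t \<noteq> 0\<close> by simp
    show "a = k \<cdot>\<^sub>v ((1 / t) \<cdot>\<^sub>v z) - B *\<^sub>v ((1 / t) \<cdot>\<^sub>v z)"
    proof (intro eq_vecI)
      fix i assume "i < dim_vec (k \<cdot>\<^sub>v ((1 / t) \<cdot>\<^sub>v z) - B *\<^sub>v ((1 / t) \<cdot>\<^sub>v z))"
      then have i: "i < m" using B by simp
      have "B *\<^sub>v ((1 / t) \<cdot>\<^sub>v z) = (1 / t) \<cdot>\<^sub>v (B *\<^sub>v z)" by (rule mult_mat_vec[OF B z])
      then show "a $ i = (k \<cdot>\<^sub>v ((1 / t) \<cdot>\<^sub>v z) - B *\<^sub>v ((1 / t) \<cdot>\<^sub>v z)) $ i"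
        using Bz_i[OF i] i B z \<open>t \<noteq> 0\<close> by (simp add: field_simps)
    qed (use a B in simp)
  qed
qed

text \<open>
  Since \<open>(k - B)(k + B) a = (k\<^sup>2 - r\<^sup>2) a\<close>, the vector \<open>y = (k + B) a / (k\<^sup>2 - r\<^sup>2)\<close> solves
  \<open>(k - B) y = a\<close>, and the secular equation says that \<open>a \<bullet> y = k\<close>. So \<open>(1, y)\<close> is an
  eigenvector for \<open>k\<close>.
\<close>

lemma abs_le_bordered_real_spectral_radius:
  assumes B: "(B :: real mat) \<in> carrier_mat m m" and a: "a \<in> carrier_vec m"
    and BBa: "B *\<^sub>v (B *\<^sub>v a) = r\<^sup>2 \<cdot>\<^sub>v a"
    and gt: "r\<^sup>2 < k\<^sup>2"
    and secular: "k * (k\<^sup>2 - r\<^sup>2 - a \<bullet> a) = a \<bullet> (B *\<^sub>v a)"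
  shows "\<bar>k\<bar> \<le> real_spectral_radius (bordered_mat a B)"
proof -
  define c where "c = 1 / (k\<^sup>2 - r\<^sup>2)"
  define y where "y = c \<cdot>\<^sub>v (k \<cdot>\<^sub>v a + B *\<^sub>v a)"
  have Ba: "B *\<^sub>v a \<in> carrier_vec m" using B a by auto
  have y: "y \<in> carrier_vec m" using Ba a unfolding y_def by simp
  have "k * (k\<^sup>2 - r\<^sup>2) = k * (a \<bullet> a) + a \<bullet> (B *\<^sub>v a)" using secular by (simp add: algebra_simps)
  then have "k = c * (k * (a \<bullet> a) + a \<bullet> (B *\<^sub>v a))" using gt unfolding c_def by (simp add: field_simps)
  then have ay: "a \<bullet> y = k"
    using a Ba unfolding y_def by (simp add: scalar_prod_add_distrib[of _ m])
  have "B *\<^sub>v y = c \<cdot>\<^sub>v (k \<cdot>\<^sub>v (B *\<^sub>v a) + r\<^sup>2 \<cdot>\<^sub>v a)"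
    using a Ba unfolding y_def
    by (simp add: mult_mat_vec[OF B] mult_add_distrib_mat_vec[OF B] BBa)
  then have "1 \<cdot>\<^sub>v a + B *\<^sub>v y = k \<cdot>\<^sub>v y"
  proof -
    have c1: "c * (k\<^sup>2 - r\<^sup>2) = 1" using gt unfolding c_def by simp
    have eq: "x + c * (k * b + r\<^sup>2 * x) = k * (c * (k * x + b))" for x b
    proof -
      have "x = c * (k\<^sup>2 - r\<^sup>2) * x" using c1 by simp
      then show ?thesis by (simp add: algebra_simps power2_eq_square)
    qed
    assume "B *\<^sub>v y = c \<cdot>\<^sub>v (k \<cdot>\<^sub>v (B *\<^sub>v a) + r\<^sup>2 \<cdot>\<^sub>v a)"
    then show ?thesis using a Ba B unfolding y_def by (intro eq_vecI) (simp_all add: eq)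
  qed
  then have "bordered_mat a B *\<^sub>v vCons 1 y = k \<cdot>\<^sub>v vCons 1 y"
    unfolding bordered_mat_mult_vCons[OF B a y] ay
    by (intro eq_vecI) (auto simp: vec_index_vCons)
  moreover have "vCons 1 y \<noteq> 0\<^sub>v (Suc m)" unfolding zero_vec_Suc by simp
  ultimately show ?thesis
    using abs_eigenvalue_le_real_spectral_radius[OF bordered_mat_carrier[OF B a], of "vCons 1 y"] y
    by simp
qed

section \<open>The bound and its equality case\<close>

text \<open>
  Let \<open>A\<close> be the bordered matrix. When \<open>\<rho>(A) \<le> r\<close> the bound is trivial because
  \<open>0 \<le> \<nu> \<le> \<theta>\<close>, and equality forces \<open>\<nu> = 0\<close>, that is \<open>a = 0\<close>. Otherwise
  the secular inequality applies to a real eigenvalue \<open>k\<close> of modulus \<open>\<rho>(A)\<close>; squaring it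
  compares \<open>k\<^sup>2 - r\<^sup>2\<close> with the roots of the cubic.
\<close>

lemma bordered_real_spectral_radius_bound:
  assumes m: "m > 0" and B: "(B :: real mat) \<in> carrier_mat m m" and sym: "B\<^sup>T = B"
    and a: "a \<in> carrier_vec m"
  defines "r \<equiv> real_spectral_radius B"
  defines "\<theta> \<equiv> Max {x. poly (g_poly r (a \<bullet> a) \<bar>a \<bullet> (B *\<^sub>v a)\<bar>) x = 0}"
  shows "(real_spectral_radius (bordered_mat a B))\<^sup>2 \<le> r\<^sup>2 + \<theta>"
    and "(real_spectral_radius (bordered_mat a B))\<^sup>2 = r\<^sup>2 + \<theta> \<Longrightarrow> B *\<^sub>v (B *\<^sub>v a) = r\<^sup>2 \<cdot>\<^sub>v a"
proof -
  let ?\<nu> = "a \<bullet> a" and ?s = "a \<bullet> (B *\<^sub>v a)"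
  have nu: "0 \<le> ?\<nu>" by (rule scalar_prod_self_nonneg)
  note max_root = g_poly_max_root[OF nu, of r "\<bar>?s\<bar>", folded \<theta>_def]
  note le_max = g_poly_nonpos_le_max_root[OF nu, of _ r "\<bar>?s\<bar>", folded \<theta>_def]
  have nu_le: "?\<nu> \<le> \<theta>" by (rule le_max) simp
  have r: "0 \<le> r" unfolding r_def by (rule real_spectral_radius_nonneg[OF B m])
  have bound: "(B *\<^sub>v v) \<bullet> (B *\<^sub>v v) \<le> r\<^sup>2 * (v \<bullet> v)" if "v \<in> carrier_vec m" for v
    unfolding r_def by (rule symmetric_norm_le_real_spectral_radius[OF B sym that])
  obtain k v where v: "v \<in> carrier_vec (Suc m)" "v \<noteq> 0\<^sub>v (Suc m)" "bordered_mat a B *\<^sub>v v = k \<cdot>\<^sub>v v"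
    and k: "\<bar>k\<bar> = real_spectral_radius (bordered_mat a B)"
    by (rule symmetric_real_spectral_radius_attained
        [OF bordered_mat_carrier[OF B a] bordered_mat_transpose[OF B sym a] zero_less_Suc])
  have k2: "(real_spectral_radius (bordered_mat a B))\<^sup>2 = k\<^sup>2" unfolding k[symmetric] by simp
  have "k\<^sup>2 \<le> r\<^sup>2 + \<theta> \<and> (k\<^sup>2 = r\<^sup>2 + \<theta> \<longrightarrow> B *\<^sub>v (B *\<^sub>v a) = r\<^sup>2 \<cdot>\<^sub>v a)"
  proof (cases "r < \<bar>k\<bar>")
    case False
    then have "k\<^sup>2 \<le> r\<^sup>2" using abs_le_square_iff[of k r] r by simp
    moreover have "B *\<^sub>v (B *\<^sub>v a) = r\<^sup>2 \<cdot>\<^sub>v a" if "\<theta> \<le> 0"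
    proof -
      have "?\<nu> = 0" using that nu nu_le by simp
      then have "a = 0\<^sub>v m" using scalar_prod_self_eq_0_iff[OF a] by simp
      moreover have "B *\<^sub>v 0\<^sub>v m = 0\<^sub>v m" using B by auto
      moreover have "r\<^sup>2 \<cdot>\<^sub>v 0\<^sub>v m = 0\<^sub>v m" by (intro eq_vecI) auto
      ultimately show ?thesis by simp
    qed
    ultimately show ?thesis using nu nu_le by force
  next
    case True
    then obtain y where y: "y \<in> carrier_vec m" "a = k \<cdot>\<^sub>v y - B *\<^sub>v y" "a \<bullet> y = k"
      using bordered_eigenvector_normalized[OF B sym a v] unfolding r_def by blast
    note s = secular_inequality_abs[OF B sym bound r True y]
    have le: "k\<^sup>2 - r\<^sup>2 \<le> \<theta>"
    proof (cases "?\<nu> \<le> k\<^sup>2 - r\<^sup>2")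
      case nu_x: True
      have "(\<bar>k\<bar> * (k\<^sup>2 - r\<^sup>2 - ?\<nu>))\<^sup>2 \<le> \<bar>?s\<bar>\<^sup>2"
        using s(1) nu_x by (intro power_mono) auto
      then show ?thesis by (intro le_max) (simp add: power_mult_distrib mult.commute)
    qed (use nu_le in simp)
    have "B *\<^sub>v (B *\<^sub>v a) = r\<^sup>2 \<cdot>\<^sub>v a" if eq: "k\<^sup>2 = r\<^sup>2 + \<theta>"
    proof (rule s(2))
      show "\<bar>k\<bar> * (k\<^sup>2 - r\<^sup>2 - ?\<nu>) = \<bar>?s\<bar>"
      proof (rule power2_eq_imp_eq)
        show "(\<bar>k\<bar> * (k\<^sup>2 - r\<^sup>2 - ?\<nu>))\<^sup>2 = \<bar>?s\<bar>\<^sup>2"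
          using max_root eq by (simp add: power_mult_distrib mult.commute)
        show "0 \<le> \<bar>k\<bar> * (k\<^sup>2 - r\<^sup>2 - ?\<nu>)" using nu_le eq by simp
      qed simp
    qed
    then show ?thesis using le by simp
  qed
  then show "(real_spectral_radius (bordered_mat a B))\<^sup>2 \<le> r\<^sup>2 + \<theta>"
    and "(real_spectral_radius (bordered_mat a B))\<^sup>2 = r\<^sup>2 + \<theta> \<Longrightarrow> B *\<^sub>v (B *\<^sub>v a) = r\<^sup>2 \<cdot>\<^sub>v a"
    unfolding k2 by auto
qed

text \<open>
  The case \<open>\<theta> = 0\<close> is degenerate: then \<open>a = 0\<close>, and the bordered matrix inherits the
  eigenvalues of \<open>B\<close>.
\<close>

lemma bordered_real_spectral_radius_ge:
  assumes m: "m > 0" and B: "(B :: real mat) \<in> carrier_mat m m" and sym: "B\<^sup>T = B"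
    and a: "a \<in> carrier_vec m"
  defines "r \<equiv> real_spectral_radius B"
  defines "\<theta> \<equiv> Max {x. poly (g_poly r (a \<bullet> a) \<bar>a \<bullet> (B *\<^sub>v a)\<bar>) x = 0}"
  assumes BBa: "B *\<^sub>v (B *\<^sub>v a) = r\<^sup>2 \<cdot>\<^sub>v a"
  shows "r\<^sup>2 + \<theta> \<le> (real_spectral_radius (bordered_mat a B))\<^sup>2"
proof -
  let ?\<nu> = "a \<bullet> a" and ?s = "a \<bullet> (B *\<^sub>v a)"
  have nu: "0 \<le> ?\<nu>" by (rule scalar_prod_self_nonneg)
  note max_root = g_poly_max_root[OF nu, of r "\<bar>?s\<bar>", folded \<theta>_def]
  note le_max = g_poly_nonpos_le_max_root[OF nu, of _ r "\<bar>?s\<bar>", folded \<theta>_def]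
  have nu_le: "?\<nu> \<le> \<theta>" by (rule le_max) simp
  show ?thesis
  proof (cases "\<theta> = 0")
    case True
    obtain k v where v: "v \<in> carrier_vec m" "v \<noteq> 0\<^sub>v m" "B *\<^sub>v v = k \<cdot>\<^sub>v v" and k: "\<bar>k\<bar> = r"
      unfolding r_def by (rule symmetric_real_spectral_radius_attained[OF B sym m])
    have "a = 0\<^sub>v m" using scalar_prod_self_eq_0_iff[OF a] nu nu_le True by simp
    then have "bordered_mat a B *\<^sub>v vCons 0 v = k \<cdot>\<^sub>v vCons 0 v"
      using v B unfolding bordered_mat_mult_vCons[OF B a v(1)]
      by (intro eq_vecI) (auto simp: vec_index_vCons)
    moreover have "vCons 0 v \<noteq> 0\<^sub>v (Suc m)" using v(2) unfolding zero_vec_Suc by simp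
    ultimately have "r \<le> real_spectral_radius (bordered_mat a B)"
      using abs_eigenvalue_le_real_spectral_radius[OF bordered_mat_carrier[OF B a], of "vCons 0 v" k] v(1) k
      by simp
    then show ?thesis using True k power_mono[of r _ 2] by auto
  next
    case False
    then have theta: "0 < \<theta>" using nu nu_le by simp
    define l where "l = sqrt (r\<^sup>2 + \<theta>)"
    have l: "0 \<le> l" "l\<^sup>2 = r\<^sup>2 + \<theta>" using theta unfolding l_def by simp_all
    \<comment> \<open>the secular equation fixes the sign of the eigenvalue to be that of \<open>a \<bullet> B a\<close>\<close>
    define k where "k = (if 0 \<le> ?s then l else - l)"
    have k: "\<bar>k\<bar> = l" "k\<^sup>2 = r\<^sup>2 + \<theta>" using l unfolding k_def by auto
    have "l * (\<theta> - ?\<nu>) = \<bar>?s\<bar>"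
    proof (rule power2_eq_imp_eq)
      show "(l * (\<theta> - ?\<nu>))\<^sup>2 = \<bar>?s\<bar>\<^sup>2"
        using max_root l by (simp add: power_mult_distrib mult.commute)
      show "0 \<le> l * (\<theta> - ?\<nu>)" using nu_le l by simp
    qed simp
    then have "k * (k\<^sup>2 - r\<^sup>2 - ?\<nu>) = ?s" unfolding k(2) unfolding k_def by auto
    then have "\<bar>k\<bar> \<le> real_spectral_radius (bordered_mat a B)"
      using theta k by (intro abs_le_bordered_real_spectral_radius[OF B a BBa]) auto
    then show ?thesis using k l power_mono[of l _ 2] by auto
  qed
qed

theorem theorem2p5:
  fixes n :: nat and A B :: "real mat" and a :: "real vec"
    and \<rho>\<^sub>2 \<nu> \<mu> \<theta> :: real
  assumes "n \<ge> 2"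
    and "B \<in> carrier_mat (n - 1) (n - 1)"
    and "B\<^sup>T = B"
    and "a \<in> carrier_vec (n - 1)"
    and "A = bordered_mat a B"
    and "\<rho>\<^sub>2 = real_spectral_radius B"
    and "\<nu> = a \<bullet> a"
    and "\<mu> = \<bar>a \<bullet> (B *\<^sub>v a)\<bar>"
    and "\<theta> = Max {x. poly (g_poly \<rho>\<^sub>2 \<nu> \<mu>) x = 0}"
  shows "(real_spectral_radius A)\<^sup>2 = \<rho>\<^sub>2\<^sup>2 + \<theta> \<longleftrightarrow> (B ^\<^sub>m 2) *\<^sub>v a = \<rho>\<^sub>2\<^sup>2 \<cdot>\<^sub>v a"
proof -
  have m: "n - 1 > 0" using assms(1) by simp
  have "(B ^\<^sub>m 2) *\<^sub>v a = B *\<^sub>v (B *\<^sub>v a)"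
    using assms(2,4) by (simp add: numeral_2_eq_2)
  moreover note bordered_real_spectral_radius_bound[OF m assms(2,3,4)]
    bordered_real_spectral_radius_ge[OF m assms(2,3,4)]
  ultimately show ?thesis unfolding assms(5-9) by (metis order_antisym)
qed

end
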